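(* Let $h\ge 2$ be an integer. Let $\mathcal{H}$ be a complex vector space of dimension $h^4$, let $A$ be an endomorphism of $\mathcal{H}$ with $A^h=0$, and let $\mathcal{H}_I\subset\mathcal{H}$ be a linear subspace with $A(\mathcal{H}_I)\subset\mathcal{H}_I$ such that $\dim H_{(n)}(\mathcal{H}_I,A)=1$ for all $n\in\{1,\dots,h-1\}$. Then there is no endomorphism $Q$ of $\mathcal{H}$ with $Q^h=0$ such that $$H_{(n)}(\mathcal{H},Q)\cong H_{(n)}(\mathcal{H}_I,A)\quad\text{for all } n\in\{1,\dots,h-1\}.$$
   Context: For a vector space $E$ with an endomorphism $\delta$ satisfying $\delta^h=0$, the generalized homology is the family of vector spaces $H_{(n)}(E,\delta)=\ker(\delta^n)/\mathrm{Im}(\delta^{h-n})$, $1\le n\le h-1$. $H_{(n)}(\mathcal{H}_I,A)$ is computed with the restriction of $A$ to $\mathcal{H}_I$. The isomorphism in the claim is as vector spaces. *)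

theory Defs
  imports Complex_Main "HOL-Algebra.QuotRing" "Jordan_Normal_Form.VS_Connect"
begin

text \<open>
  Vector spaces are the carrier-based \<open>vectorspace K V\<close> of the library; the complex numbers as
  a base field are \<open>class_ring\<close> at type \<^typ>\<open>complex\<close>.
\<close>

text \<open>
  The scalar multiple of a coset is written as a union over its representatives, as in
  \<^const>\<open>rcoset_mult\<close>, because the elementwise image of a coset under multiplication by zero
  is not a coset.
\<close>

definition quotient_space ::
  "('k, 'v, 'm) module_scheme \<Rightarrow> 'v set \<Rightarrow> ('k, 'v set) module" where
  "quotient_space V W =
    \<lparr>carrier = a_rcosets\<^bsub>V\<^esub> W, mult = undefined, one = undefined,
     zero = W, add = set_add V, smult = (\<lambda>c X. \<Union>x\<in>X. W +>\<^bsub>V\<^esub> (c \<odot>\<^bsub>V\<^esub> x))\<rparr>"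

lemma (in vectorspace) quotient_space_operations:
  assumes W: "VectorSpace.subspace K W V"
  shows "\<lbrakk>x \<in> carrier V; y \<in> carrier V\<rbrakk> \<Longrightarrow>
      (W +>\<^bsub>V\<^esub> x) \<oplus>\<^bsub>quotient_space V W\<^esub> (W +>\<^bsub>V\<^esub> y) = W +>\<^bsub>V\<^esub> (x \<oplus>\<^bsub>V\<^esub> y)"
    and "\<lbrakk>c \<in> carrier K; x \<in> carrier V\<rbrakk> \<Longrightarrow>
      c \<odot>\<^bsub>quotient_space V W\<^esub> (W +>\<^bsub>V\<^esub> x) = W +>\<^bsub>V\<^esub> (c \<odot>\<^bsub>V\<^esub> x)"
    and "W +>\<^bsub>V\<^esub> \<zero>\<^bsub>V\<^esub> = W"
proof -
  have sub: "submodule K W V" using W by (simp add: VectorSpace.subspace_def)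
  interpret S: submodule K W V by (rule sub)
  have inv: "\<ominus>\<^bsub>V\<^esub> w \<in> W" if "w \<in> W" for w
  proof -
    have "(\<ominus>\<^bsub>K\<^esub> \<one>\<^bsub>K\<^esub>) \<odot>\<^bsub>V\<^esub> w \<in> W"
      by (rule S.smult_closed[OF R.a_inv_closed[OF R.one_closed] that])
    moreover have "w \<in> carrier V" using that S.subset by blast
    ultimately show ?thesis by (simp only: smult_minus_1)
  qed
  have ne: "W \<noteq> {}" using S.zero_closed by blast
  have sg: "subgroup W (add_monoid V)"
    by (rule group.subgroupI[OF M.a_group])
       (simp_all add: S.subset inv ne S.m_closed flip: a_inv_def)
  interpret A: abelian_subgroup W V
    by (rule abelian_subgroupI3) (use sg M.abelian_group_axioms in \<open>auto simp: additive_subgroup_def\<close>)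
  show "(W +>\<^bsub>V\<^esub> x) \<oplus>\<^bsub>quotient_space V W\<^esub> (W +>\<^bsub>V\<^esub> y) = W +>\<^bsub>V\<^esub> (x \<oplus>\<^bsub>V\<^esub> y)"
    if "x \<in> carrier V" "y \<in> carrier V"
    using that A.a_rcos_sum by (simp add: quotient_space_def)
  show "W +>\<^bsub>V\<^esub> \<zero>\<^bsub>V\<^esub> = W"
    using S.subset by (rule M.a_coset_add_zero)
  show "c \<odot>\<^bsub>quotient_space V W\<^esub> (W +>\<^bsub>V\<^esub> x) = W +>\<^bsub>V\<^esub> (c \<odot>\<^bsub>V\<^esub> x)"
    if c: "c \<in> carrier K" and x: "x \<in> carrier V"
  proof -
    have eq: "W +>\<^bsub>V\<^esub> (c \<odot>\<^bsub>V\<^esub> y) = W +>\<^bsub>V\<^esub> (c \<odot>\<^bsub>V\<^esub> x)" if y: "y \<in> W +>\<^bsub>V\<^esub> x" for y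
    proof -
      obtain w where w: "w \<in> W" "y = w \<oplus>\<^bsub>V\<^esub> x" using y by (auto simp: a_r_coset_def')
      then have "w \<in> carrier V" using S.subset by auto
      then have "c \<odot>\<^bsub>V\<^esub> y = c \<odot>\<^bsub>V\<^esub> w \<oplus>\<^bsub>V\<^esub> c \<odot>\<^bsub>V\<^esub> x" using c x w by (simp add: smult_r_distr)
      then have "c \<odot>\<^bsub>V\<^esub> y \<in> W +>\<^bsub>V\<^esub> (c \<odot>\<^bsub>V\<^esub> x)" using w c by (auto simp: a_r_coset_def')
      from A.a_repr_independence'[OF this smult_closed[OF c x]] show ?thesis by (rule sym)
    qed
    have self: "x \<in> W +>\<^bsub>V\<^esub> x" by (rule A.a_rcos_self[OF x])
    have "(\<Union>y\<in>W +>\<^bsub>V\<^esub> x. W +>\<^bsub>V\<^esub> (c \<odot>\<^bsub>V\<^esub> y)) =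
        (\<Union>y\<in>W +>\<^bsub>V\<^esub> x. W +>\<^bsub>V\<^esub> (c \<odot>\<^bsub>V\<^esub> x))"
      by (rule SUP_cong[OF refl eq])
    also have "\<dots> = W +>\<^bsub>V\<^esub> (c \<odot>\<^bsub>V\<^esub> x)" using self by blast
    finally show ?thesis by (simp only: quotient_space_def module.simps)
  qed
qed

lemma (in vectorspace) quotient_space_is_vs:
  assumes W: "VectorSpace.subspace K W V"
  shows "vectorspace K (quotient_space V W)"
proof -
  let ?Q = "quotient_space V W"
  note ops = quotient_space_operations[OF W]
  have car: "carrier ?Q = (\<lambda>x. W +>\<^bsub>V\<^esub> x) ` carrier V"
    by (auto simp: quotient_space_def A_RCOSETS_def')
  have z: "\<zero>\<^bsub>?Q\<^esub> = W +>\<^bsub>V\<^esub> \<zero>\<^bsub>V\<^esub>"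
    using ops(3) by (simp add: quotient_space_def)
  show ?thesis
  proof (rule vs_criteria)
    show "\<zero>\<^bsub>?Q\<^esub> \<in> carrier ?Q"
      unfolding car z by blast
    show "\<forall>v\<in>carrier ?Q. v \<oplus>\<^bsub>?Q\<^esub> \<zero>\<^bsub>?Q\<^esub> = v"
      unfolding car z by (auto simp: ops(1))
    show "\<forall>v\<in>carrier ?Q. \<exists>n\<in>carrier ?Q. v \<oplus>\<^bsub>?Q\<^esub> n = \<zero>\<^bsub>?Q\<^esub>"
    proof
      fix v assume "v \<in> carrier ?Q"
      then obtain x where x: "x \<in> carrier V" "v = W +>\<^bsub>V\<^esub> x" by (auto simp: car)
      then show "\<exists>n\<in>carrier ?Q. v \<oplus>\<^bsub>?Q\<^esub> n = \<zero>\<^bsub>?Q\<^esub>"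
        by (intro bexI[of _ "W +>\<^bsub>V\<^esub> (\<ominus>\<^bsub>V\<^esub> x)"]) (auto simp: car z ops(1) M.r_neg)
    qed
  qed (auto simp: car ops(1,2) M.a_ac smult_l_distr smult_r_distr smult_assoc1 field_axioms)
qed

definition nilpotent_endo ::
  "('k, 'm) ring_scheme \<Rightarrow> nat \<Rightarrow> ('k, 'v, 'n) module_scheme \<Rightarrow> ('v \<Rightarrow> 'v) \<Rightarrow> bool" where
  "nilpotent_endo K h E \<delta> \<longleftrightarrow>
    linear_map K E E \<delta> \<and> (\<forall>v\<in>carrier E. (\<delta> ^^ h) v = \<zero>\<^bsub>E\<^esub>)"

definition gen_homology ::
  "nat \<Rightarrow> ('k, 'v, 'm) module_scheme \<Rightarrow> ('v \<Rightarrow> 'v) \<Rightarrow> nat \<Rightarrow> ('k, 'v set) module" where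
  "gen_homology h E \<delta> n =
    quotient_space (E\<lparr>carrier := {v \<in> carrier E. (\<delta> ^^ n) v = \<zero>\<^bsub>E\<^esub>}\<rparr>)
      ((\<delta> ^^ (h - n)) ` carrier E)"

definition vs_isomorphic ::
  "('k, 'r) ring_scheme \<Rightarrow> ('k, 'v, 'm) module_scheme \<Rightarrow> ('k, 'w, 'n) module_scheme \<Rightarrow> bool" where
  "vs_isomorphic K V W \<longleftrightarrow> (\<exists>f \<in> LinearCombinations.module_hom K V W. bij_betw f (carrier V) (carrier W))"

end

theory Submission
  imports Defs
begin

text \<open>
  The obstruction is divisibility, and it is visible already in degree \<open>n = 1\<close>: if
  \<open>Q\<^sup>h = 0\<close> on a finite-dimensional space \<open>V\<close> and \<open>dim H\<^sub>(\<^sub>1\<^sub>)(V, Q) = 1\<close>, then \<open>h\<close> does not divide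
  \<open>dim V\<close>, whereas \<open>h\<close> divides \<open>h\<^sup>4\<close>. In terms of Jordan blocks, only blocks of size less
  than \<open>h\<close> contribute to the homology, each of them adding 1 to \<open>dim H\<^sub>(\<^sub>1\<^sub>)\<close>; so there is exactly one such
  block, and \<open>dim V\<close> is congruent to its size modulo \<open>h\<close>.

  The proof replaces the Jordan form by the numbers \<open>k i = dim (ker Q \<inter> im Q\<^sup>i)\<close>, that is,
  the numbers of Jordan blocks of size greater than \<open>i\<close>. They are non-increasing in \<open>i\<close>,
  and rank-nullity for \<open>Q\<close> on each image \<open>im Q\<^sup>i\<close> gives \<open>dim V = k 0 + \<dots> + k (h - 1)\<close>
  (\<open>dim_eq_sum_dim_kernel_image\<close>). Since \<open>Q\<^sup>h = 0\<close>, all of \<open>im Q\<^sup>h\<^sup>-\<^sup>1\<close> lies in \<open>ker Q\<close>, so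
  \<open>dim H\<^sub>(\<^sub>1\<^sub>) = k 0 - k (h - 1)\<close> (\<open>dim_gen_homology\<close>). When this difference is 1, each \<open>k i\<close> equals
  \<open>k (h - 1)\<close> or \<open>k (h - 1) + 1\<close>, with the larger value at \<open>i = 0\<close> and the smaller one
  at \<open>i = h - 1\<close>; hence the sum is not a multiple of \<open>h\<close> (\<open>drop_by_one_not_dvd_sum\<close>).

  In the theorem, the value 1 of \<open>dim H\<^sub>(\<^sub>1\<^sub>)\<close> is transported from \<open>(\<H>\<^sub>I, A)\<close> to \<open>(\<H>, Q)\<close> along the
  isomorphism.
\<close>

section \<open>Subspaces and quotients of finite-dimensional spaces\<close>

context vectorspace
begin

lemma subspace_subset: "VectorSpace.subspace K W V \<Longrightarrow> W \<subseteq> carrier V"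
  using submodule.subset is_module by blast

lemma subspace_nested:
  assumes U: "VectorSpace.subspace K U V" and W: "VectorSpace.subspace K W V" and UW: "U \<subseteq> W"
  shows "VectorSpace.subspace K U (vs W)"
proof -
  interpret U: submodule K U V using U by simp
  interpret W: vectorspace K "vs W" by (rule subspace_is_vs[OF W])
  have "submodule K U (vs W)"
    by (rule submodule.intro) (use UW W.module_axioms in auto)
  then show ?thesis
    by (simp add: VectorSpace.subspace_def W.vectorspace_axioms)
qed

text \<open>
  Linear independence in \<open>W\<close> is linear independence in \<open>V\<close>, so independent subsets of \<open>W\<close>
  have bounded size, and a maximal one is a finite basis.
\<close>
lemma subspace_fin_dim:
  assumes fd: fin_dim and W: "VectorSpace.subspace K W V"
  shows "vectorspace.fin_dim K (vs W)"
proof -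
  interpret W: vectorspace K "vs W" by (rule subspace_is_vs[OF W])
  have sm: "submodule K W V" using W by simp
  then have WV: "W \<subseteq> carrier V" by (rule submodule.subset)
  have small: "finite A \<and> card A \<le> dim" if A: "A \<subseteq> carrier (vs W) \<and> W.lin_indpt A" for A
  proof -
    have "lin_indpt A" using A span_li_not_depend(2)[OF _ sm, of A] by simp
    then show ?thesis using li_le_dim[OF fd] A WV by auto
  qed
  have "\<exists>A. finite A \<and> maximal A (\<lambda>S. S \<subseteq> carrier (vs W) \<and> W.lin_indpt S)"
    by (rule maximal_exists[where B = "{}", OF small]) (auto simp: W.lin_dep_def)
  then obtain A where "finite A" "W.basis A"
    using W.max_li_is_basis by blast
  then show ?thesis unfolding W.fin_dim_def W.basis_def by blast
qed

lemma quotient_carrier: "(\<lambda>x. W +>\<^bsub>V\<^esub> x) ` carrier V = carrier (quotient_space V W)"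
  by (auto simp: quotient_space_def A_RCOSETS_def')

lemma quotient_linear_map:
  assumes W: "VectorSpace.subspace K W V"
  shows "linear_map K V (quotient_space V W) (\<lambda>x. W +>\<^bsub>V\<^esub> x)"
proof -
  interpret Q: vectorspace K "quotient_space V W" by (rule quotient_space_is_vs[OF W])
  have "(\<lambda>x. W +>\<^bsub>V\<^esub> x) \<in> LinearCombinations.module_hom K V (quotient_space V W)"
    by (simp add: LinearCombinations.module_hom_def Pi_iff quotient_space_operations[OF W]
      flip: quotient_carrier)
  then show ?thesis
    by (intro linear_map.intro mod_hom.intro mod_hom_axioms.intro
      vectorspace_axioms module_axioms Q.vectorspace_axioms Q.module_axioms)
qed

lemma coset_eq_subspace_iff:
  assumes W: "VectorSpace.subspace K W V" and x: "x \<in> carrier V"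
  shows "W +>\<^bsub>V\<^esub> x = W \<longleftrightarrow> x \<in> W"
proof -
  interpret W: submodule K W V using W by simp
  have neg: "\<ominus>\<^bsub>V\<^esub> w \<in> W" if "w \<in> W" for w
  proof -
    have "(\<ominus>\<^bsub>K\<^esub> \<one>\<^bsub>K\<^esub>) \<odot>\<^bsub>V\<^esub> w \<in> W"
      by (rule W.smult_closed[OF R.a_inv_closed[OF R.one_closed] that])
    moreover have "w \<in> carrier V" using that W.subset by blast
    ultimately show ?thesis by (simp only: smult_minus_1)
  qed
  have "W \<noteq> {}" using W.zero_closed by blast
  then have sg: "subgroup W (add_monoid V)"
    by (intro group.subgroupI[OF M.a_group])
      (simp_all add: W.subset neg flip: a_inv_def)
  show ?thesis
    using M.a_coset_join1[OF _ x sg] M.a_coset_join2[OF x sg] by blast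
qed

text \<open>Rank-nullity for the canonical projection, whose kernel is \<open>W\<close>.\<close>
lemma
  assumes fd: fin_dim and W: "VectorSpace.subspace K W V"
  shows quotient_fin_dim: "vectorspace.fin_dim K (quotient_space V W)"
    and dim_quotient: "vectorspace.dim K (quotient_space V W) + vectorspace.dim K (vs W) = dim"
proof -
  interpret L: linear_map K V "quotient_space V W" "\<lambda>x. W +>\<^bsub>V\<^esub> x"
    by (rule quotient_linear_map[OF W])
  have WV: "W \<subseteq> carrier V" by (rule subspace_subset[OF W])
  show "vectorspace.fin_dim K (quotient_space V W)"
    by (rule L.surj_fin_dim[OF fd quotient_carrier])
  have im: "L.imT = carrier (quotient_space V W)"
    by (simp add: L.im_def quotient_carrier)
  have ker: "L.kerT = W"
  proof -
    have zero: "\<zero>\<^bsub>quotient_space V W\<^esub> = W" by (simp add: quotient_space_def)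
    show ?thesis
      using WV coset_eq_subspace_iff[OF W] unfolding L.ker_def zero by auto
  qed
  show "vectorspace.dim K (quotient_space V W) + vectorspace.dim K (vs W) = dim"
    using L.rank_nullity[OF fd] unfolding im ker by simp
qed

lemma dim_subspace_mono:
  assumes fd: fin_dim
    and U: "VectorSpace.subspace K U V" and W: "VectorSpace.subspace K W V" and UW: "U \<subseteq> W"
  shows "vectorspace.dim K (vs U) \<le> vectorspace.dim K (vs W)"
proof -
  interpret W: vectorspace K "vs W" by (rule subspace_is_vs[OF W])
  show ?thesis
    using W.dim_quotient[OF subspace_fin_dim[OF fd W] subspace_nested[OF U W UW]] by simp
qed

section \<open>Iterating an endomorphism\<close>
lemma linear_map_funpow:
  assumes "linear_map K V V T"
  shows "linear_map K V V (T ^^ n)"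
proof -
  interpret T: linear_map K V V T by fact
  have "T ^^ n \<in> LinearCombinations.module_hom K V V"
  proof (induction n)
    case 0 show ?case by (auto simp: LinearCombinations.module_hom_def)
  next
    case (Suc n)
    then show ?case by (auto simp: LinearCombinations.module_hom_def Pi_iff)
  qed
  then show ?thesis
    by (intro linear_map.intro mod_hom.intro mod_hom_axioms.intro vectorspace_axioms module_axioms)
qed

lemma subspace_image_funpow:
  assumes "linear_map K V V T"
  shows "VectorSpace.subspace K ((T ^^ n) ` carrier V) V"
proof -
  interpret L: linear_map K V V "T ^^ n" by (rule linear_map_funpow[OF assms])
  show ?thesis using L.imT_is_subspace by (simp add: L.im_def)
qed

lemma subspace_kernel_funpow:
  assumes "linear_map K V V T"
  shows "VectorSpace.subspace K {v \<in> carrier V. (T ^^ n) v = \<zero>\<^bsub>V\<^esub>} V"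
proof -
  interpret L: linear_map K V V "T ^^ n" by (rule linear_map_funpow[OF assms])
  show ?thesis using L.kerT_is_subspace by (simp add: L.ker_def)
qed

lemma linear_map_restrict:
  assumes T: "linear_map K V V T" and W: "VectorSpace.subspace K W V"
  shows "linear_map K (vs W) V T"
proof -
  interpret T: linear_map K V V T by fact
  interpret W: vectorspace K "vs W" by (rule subspace_is_vs[OF W])
  have "T \<in> LinearCombinations.module_hom K (vs W) V"
    using subspace_subset[OF W] T.f_hom
    by (simp add: LinearCombinations.module_hom_def Pi_iff subset_iff)
  then show ?thesis
    by (intro linear_map.intro mod_hom.intro mod_hom_axioms.intro
      W.vectorspace_axioms W.module_axioms vectorspace_axioms module_axioms)
qed

lemma rank_nullity_restrict:
  assumes fd: fin_dim and T: "linear_map K V V T" and W: "VectorSpace.subspace K W V"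
  shows "vectorspace.dim K (vs (T ` W)) + vectorspace.dim K (vs {v \<in> W. T v = \<zero>\<^bsub>V\<^esub>})
    = vectorspace.dim K (vs W)"
proof -
  interpret L: linear_map K "vs W" V T by (rule linear_map_restrict[OF T W])
  show ?thesis
    using L.rank_nullity[OF subspace_fin_dim[OF fd W]] by (simp add: L.im_def L.ker_def)
qed

lemma subspace_kernel_restrict:
  assumes T: "linear_map K V V T" and W: "VectorSpace.subspace K W V"
  shows "VectorSpace.subspace K {v \<in> W. T v = \<zero>\<^bsub>V\<^esub>} V"
proof -
  interpret T: linear_map K V V T by fact
  interpret W: submodule K W V using W by simp
  have "submodule K {v \<in> W. T v = \<zero>\<^bsub>V\<^esub>} V"
    by (rule submodule.intro) (use W.subset in \<open>auto simp: subset_iff module_axioms\<close>)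
  then show ?thesis by (simp add: VectorSpace.subspace_def vectorspace_axioms)
qed

lemma image_funpow_antimono:
  assumes T: "linear_map K V V T" and "i \<le> j"
  shows "(T ^^ j) ` carrier V \<subseteq> (T ^^ i) ` carrier V"
proof -
  interpret L: linear_map K V V "T ^^ (j - i)" by (rule linear_map_funpow[OF T])
  have "T ^^ j = T ^^ i \<circ> T ^^ (j - i)" using \<open>i \<le> j\<close> by (simp flip: funpow_add)
  then show ?thesis by auto
qed

section \<open>Generalized homology\<close>

text \<open>
  Telescoping: rank-nullity for \<open>T\<close> restricted to \<open>im T\<^sup>i\<close> says that passing to \<open>im T\<^sup>i\<^sup>+\<^sup>1\<close> loses
  exactly the dimension of \<open>ker T \<inter> im T\<^sup>i\<close>.
\<close>
lemma dim_eq_sum_dim_kernel_image: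
  assumes fd: fin_dim and T: "linear_map K V V T"
  shows "dim = (\<Sum>i<h. vectorspace.dim K (vs {v \<in> (T ^^ i) ` carrier V. T v = \<zero>\<^bsub>V\<^esub>}))
    + vectorspace.dim K (vs ((T ^^ h) ` carrier V))"
proof (induction h)
  case 0
  show ?case by simp
next
  case (Suc h)
  have "(T ^^ Suc h) ` carrier V = T ` (T ^^ h) ` carrier V" by (simp add: image_comp)
  then show ?case
    using Suc rank_nullity_restrict[OF fd T subspace_image_funpow[OF T, of h]] by simp
qed

lemma
  assumes E: "nilpotent_endo K h V T" and n: "n \<le> h"
  shows gen_homology_is_vs: "vectorspace K (gen_homology h V T n)"
    and gen_homology_fin_dim: "fin_dim \<Longrightarrow> vectorspace.fin_dim K (gen_homology h V T n)"
    and dim_gen_homology: "fin_dim \<Longrightarrow> vectorspace.dim K (gen_homology h V T n)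
      + vectorspace.dim K (vs ((T ^^ (h - n)) ` carrier V))
      = vectorspace.dim K (vs {v \<in> carrier V. (T ^^ n) v = \<zero>\<^bsub>V\<^esub>})"
proof -
  let ?Z = "{v \<in> carrier V. (T ^^ n) v = \<zero>\<^bsub>V\<^esub>}" and ?B = "(T ^^ (h - n)) ` carrier V"
  have T: "linear_map K V V T" and nil: "\<And>v. v \<in> carrier V \<Longrightarrow> (T ^^ h) v = \<zero>\<^bsub>V\<^esub>"
    using E by (auto simp: nilpotent_endo_def)
  have Z: "VectorSpace.subspace K ?Z V" by (rule subspace_kernel_funpow[OF T])
  have B: "VectorSpace.subspace K ?B V" by (rule subspace_image_funpow[OF T])
  have "T ^^ h = T ^^ n \<circ> T ^^ (h - n)" using n by (simp flip: funpow_add)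
  then have "?B \<subseteq> ?Z" using nil subspace_subset[OF B] by auto
  then have BZ: "VectorSpace.subspace K ?B (vs ?Z)" by (rule subspace_nested[OF B Z])
  interpret Z: vectorspace K "vs ?Z" by (rule subspace_is_vs[OF Z])
  show "vectorspace K (gen_homology h V T n)"
    unfolding gen_homology_def by (rule Z.quotient_space_is_vs[OF BZ])
  assume fd: fin_dim
  show "vectorspace.fin_dim K (gen_homology h V T n)"
    unfolding gen_homology_def by (rule Z.quotient_fin_dim[OF subspace_fin_dim[OF fd Z] BZ])
  show "vectorspace.dim K (gen_homology h V T n) + vectorspace.dim K (vs ?B)
      = vectorspace.dim K (vs ?Z)"
    using Z.dim_quotient[OF subspace_fin_dim[OF fd Z] BZ] by (simp add: gen_homology_def)
qed

end

text \<open>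
  Modulo \<open>h\<close> the sum is the number of indices at which \<open>k\<close> still has its larger value; index \<open>0\<close>
  is one of them and index \<open>h - 1\<close> is not, so this number lies strictly between \<open>0\<close> and \<open>h\<close>.
\<close>
lemma drop_by_one_not_dvd_sum:
  fixes k :: "nat \<Rightarrow> nat"
  assumes anti: "\<And>i. i < h \<Longrightarrow> k (h - 1) \<le> k i \<and> k i \<le> k 0"
    and drop: "k 0 = k (h - 1) + 1"
  shows "\<not> h dvd (\<Sum>i<h. k i)"
proof -
  define m where "m = k (h - 1)"
  define e where "e i = k i - m" for i
  have "h - 1 \<noteq> 0"
  proof
    assume "h - 1 = 0"
    with drop have "k 0 = k 0 + 1" by metis
    then show False by simp
  qed
  then have h: "2 \<le> h" by simp
  have k: "k i = m + e i" "e i \<le> 1" if "i < h" for i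
    using anti[OF that] drop by (auto simp: e_def m_def)
  have "(\<Sum>i<h. k i) = h * m + (\<Sum>i<h. e i)"
    by (simp add: k(1) sum.distrib)
  moreover have "(\<Sum>i<h. e i) = (\<Sum>i<h - 1. e i)"
    using h by (cases h) (auto simp: e_def m_def)
  moreover have "(\<Sum>i<h - 1. e i) \<le> (\<Sum>i<h - 1. 1)"
    by (rule sum_mono) (use k(2) in auto)
  moreover have "e 0 \<le> (\<Sum>i<h - 1. e i)"
    by (rule member_le_sum) (use h in auto)
  moreover have "e 0 = 1" using drop by (simp add: e_def m_def)
  ultimately have "0 < (\<Sum>i<h. e i)" "(\<Sum>i<h. e i) < h" 
    "(\<Sum>i<h. k i) = h * m + (\<Sum>i<h. e i)" using h by auto
  then show ?thesis
    by (auto simp: nat_dvd_not_less dvd_add_right_iff)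
qed

lemma (in vectorspace) not_dvd_dim_if_dim_gen_homology_1:
  assumes h: "2 \<le> h" and fd: fin_dim and E: "nilpotent_endo K h V T"
    and one: "vectorspace.dim K (gen_homology h V T 1) = 1"
  shows "\<not> h dvd dim"
proof -
  have T: "linear_map K V V T" and nil: "\<And>v. v \<in> carrier V \<Longrightarrow> (T ^^ h) v = \<zero>\<^bsub>V\<^esub>"
    using E by (auto simp: nilpotent_endo_def)
  define N where "N i = {v \<in> (T ^^ i) ` carrier V. T v = \<zero>\<^bsub>V\<^esub>}" for i
  define k where "k i = vectorspace.dim K (vs (N i))" for i
  have N: "VectorSpace.subspace K (N i) V" for i
    unfolding N_def by (rule subspace_kernel_restrict[OF T subspace_image_funpow[OF T]])
  have anti: "k j \<le> k i" if "i \<le> j" for i j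
    unfolding k_def
    by (rule dim_subspace_mono[OF fd N N]) (use image_funpow_antimono[OF T that] in \<open>auto simp: N_def\<close>)
  have Suc_h: "T ((T ^^ (h - 1)) v) = (T ^^ h) v" for v
    using h by (cases h) auto
  have Nlast: "N (h - 1) = (T ^^ (h - 1)) ` carrier V"
    using nil by (auto simp: N_def Suc_h[simplified])
  have "k (h - 1) = vectorspace.dim K (vs ((T ^^ (h - 1)) ` carrier V))"
    by (simp only: k_def Nlast)
  moreover have "k 0 = vectorspace.dim K (vs {v \<in> carrier V. (T ^^ 1) v = \<zero>\<^bsub>V\<^esub>})"
    by (simp add: k_def N_def)
  ultimately have drop: "k 0 = k (h - 1) + 1"
    using dim_gen_homology[OF E _ fd, of 1] h one by linarith
  have im0: "(T ^^ h) ` carrier V = {\<zero>\<^bsub>V\<^esub>}"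
    using nil M.zero_closed by force
  interpret O: vectorspace K "vs {\<zero>\<^bsub>V\<^esub>}"
    using subspace_is_vs[OF subspace_image_funpow[OF T, of h]] by (simp add: im0)
  have "O.span {\<zero>\<^bsub>V\<^esub>} = {\<zero>\<^bsub>V\<^esub>}"
    using O.span_is_subset2[of "{\<zero>\<^bsub>V\<^esub>}"] O.span_self[of "\<zero>\<^bsub>V\<^esub>"] by auto
  then have "O.dim = 0" by (intro O.dim0I) simp
  then have "dim = (\<Sum>i<h. k i)"
    using dim_eq_sum_dim_kernel_image[OF fd T, of h] by (simp add: im0 k_def N_def)
  then show ?thesis
    using drop_by_one_not_dvd_sum[of h k, OF _ drop] anti by simp
qed

lemma vs_isomorphic_dim_eq:
  assumes V: "vectorspace K V" and W: "vectorspace K W" and fd: "vectorspace.fin_dim K V"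
    and iso: "vs_isomorphic K V W"
  shows "vectorspace.dim K V = vectorspace.dim K W"
proof -
  obtain f where f: "f \<in> LinearCombinations.module_hom K V W"
    and bij: "bij_betw f (carrier V) (carrier W)"
    using iso by (auto simp: vs_isomorphic_def)
  interpret V: vectorspace K V by fact
  interpret W: vectorspace K W by fact
  interpret L: linear_map K V W f by unfold_locales (rule f)
  show ?thesis using L.dim_eq[OF fd] bij by (simp add: bij_betw_def)
qed

lemma (in vectorspace) nilpotent_endo_restrict:
  assumes E: "nilpotent_endo K h V T" and W: "VectorSpace.subspace K W V" and TW: "T ` W \<subseteq> W"
  shows "nilpotent_endo K h (vs W) T"
proof -
  interpret W: vectorspace K "vs W" by (rule subspace_is_vs[OF W])
  interpret L: linear_map K "vs W" V T
    using E by (intro linear_map_restrict[OF _ W]) (simp add: nilpotent_endo_def)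
  have "T \<in> LinearCombinations.module_hom K (vs W) (vs W)"
    using TW L.f_hom by (simp add: LinearCombinations.module_hom_def Pi_iff image_subset_iff)
  then have "linear_map K (vs W) (vs W) T"
    by (intro linear_map.intro mod_hom.intro mod_hom_axioms.intro
      W.vectorspace_axioms W.module_axioms)
  then show ?thesis
    using E subspace_subset[OF W] by (auto simp: nilpotent_endo_def)
qed

theorem mainTheorem3:
  fixes h :: nat
    and H :: "(complex, 'v) module"
    and A :: "'v \<Rightarrow> 'v"
    and HI :: "'v set"
  assumes "2 \<le> h"
    and "vectorspace class_ring H"
    and "vectorspace.fin_dim class_ring H"
    and "vectorspace.dim class_ring H = h ^ 4"
    and "nilpotent_endo class_ring h H A"
    and "VectorSpace.subspace class_ring HI H"
    and "A ` HI \<subseteq> HI"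
    and "\<forall>n\<in>{1..h - 1}.
           vectorspace.dim class_ring (gen_homology h (H\<lparr>carrier := HI\<rparr>) A n) = 1"
  shows "\<not> (\<exists>Q. nilpotent_endo class_ring h H Q \<and>
           (\<forall>n\<in>{1..h - 1}. vs_isomorphic class_ring
              (gen_homology h H Q n) (gen_homology h (H\<lparr>carrier := HI\<rparr>) A n)))"
proof
  assume "\<exists>Q. nilpotent_endo class_ring h H Q \<and>
           (\<forall>n\<in>{1..h - 1}. vs_isomorphic class_ring
              (gen_homology h H Q n) (gen_homology h (H\<lparr>carrier := HI\<rparr>) A n))"
  then obtain Q where Q: "nilpotent_endo class_ring h H Q"
    and iso: "\<forall>n\<in>{1..h - 1}. vs_isomorphic class_ring
              (gen_homology h H Q n) (gen_homology h (H\<lparr>carrier := HI\<rparr>) A n)"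
    by blast
  interpret H: vectorspace class_ring H by fact
  interpret HI: vectorspace class_ring "H\<lparr>carrier := HI\<rparr>"
    by (rule H.subspace_is_vs) fact
  have AI: "nilpotent_endo class_ring h (H\<lparr>carrier := HI\<rparr>) A"
    by (rule H.nilpotent_endo_restrict) fact+
  have h: "1 \<le> h" "1 \<in> {1..h - 1}" using \<open>2 \<le> h\<close> by auto
  have "vectorspace.dim class_ring (gen_homology h H Q 1)
      = vectorspace.dim class_ring (gen_homology h (H\<lparr>carrier := HI\<rparr>) A 1)"
    by (rule vs_isomorphic_dim_eq)
      (use H.gen_homology_is_vs[OF Q h(1)] HI.gen_homology_is_vs[OF AI h(1)]
        H.gen_homology_fin_dim[OF Q h(1) assms(3)] iso h(2) in auto)
  then have "vectorspace.dim class_ring (gen_homology h H Q 1) = 1"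
    using assms(8) h(2) by simp
  then have "\<not> h dvd h ^ 4"
    using H.not_dvd_dim_if_dim_gen_homology_1[OF \<open>2 \<le> h\<close> assms(3) Q] assms(4) by simp
  then show False by simp
qed

end
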